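(* (i) For any weighted graph $\tilde G=(\tilde V,\tilde E,\tilde\mu,\tilde w)$ with $n$ vertices and any $k\in\{1,2,\dots,n\}$, $$h_k(\tilde G)\ \ge\ \ell_k(\tilde G)\ \ge\ \underline{\ell_k}(\tilde G).$$ (ii) For any weighted forest $G=(V,E,\mu,w)$ with $n$ vertices and any $k\in\{1,2,\dots,n\}$, $$h_k(G)=\ell_k(G)=\underline{\ell_k}(G).$$
   Context: A weighted graph is a quadruple $G=(V,E,\mu,w)$ with finite vertex set $V=\{1,\dots,n\}$, edge set $E\subseteq\{\{u,v\}:u\neq v\text{ in }V\}$, vertex weight $\mu:V\to(0,\infty)$ and edge weight $w:E\to(0,\infty)$; write $\mu_v=\mu(v)$, $w_{uv}=w(\{u,v\})$. A weighted forest is a weighted graph whose underlying graph has no cycles (it need not be connected). For nonempty $A\subseteq V$, $\partial A=\{\{u,v\}\in E:u\in A,\ v\notin A\}$ and $\phi(A)=\dfrac{\sum_{\{u,v\}\in\partial A}w_{uv}}{\sum_{v\in A}\mu_v}$. $\mathcal P_m(V)$ is the set of all $m$-tuples $(A_1,\dots,A_m)$ of pairwise disjoint nonempty subsets of $V$ (their union need not be $V$). $\mathcal U(A_1,\dots,A_m)=\{A_{i_1}\cup\dots\cup A_{i_q}:1\le i_1<\dots<i_q\le m,\ 1\le q\le m\}$. For nonempty $A\subseteq V$, $h(A)=\min_{\varnothing\neq B\subseteq A}\phi(B)$. For $1\le k\le n$: $$h_k(G)=\min_{(A_1,\dots,A_k)\in\mathcal P_k(V)}\ \max_{1\le i\le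 k}\phi(A_i),$$ $$\ell_k(G)=\max_{(A_1,\dots,A_{n-k+1})\in\mathcal P_{n-k+1}(V)}\ \min_{B\in\mathcal U(A_1,\dots,A_{n-k+1})}\phi(B),$$ $$\underline{\ell_k}(G)=\max_{A\subseteq V,\ |A|=n-k+1}h(A).$$ *)

theory Defs
  imports Complex_Main "HOL-Library.Disjoint_Sets"
begin

text \<open>
  The weights are total functions, but only their values on the vertices and edges are constrained,
  and no other values enter the definitions below.
\<close>

record 'a wgraph =
  verts :: "'a set"
  edges :: "'a set set"
  vweight :: "'a \<Rightarrow> real"
  eweight :: "'a set \<Rightarrow> real"

definition weighted_graph :: "nat \<Rightarrow> nat wgraph \<Rightarrow> bool" where
  "weighted_graph n G \<longleftrightarrow>
     verts G = {1..n} \<and>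
     edges G \<subseteq> {{u, v} | u v. u \<in> verts G \<and> v \<in> verts G \<and> u \<noteq> v} \<and>
     (\<forall>v\<in>verts G. vweight G v > 0) \<and>
     (\<forall>e\<in>edges G. eweight G e > 0)"

text \<open>
  A cycle is given by its list of pairwise distinct vertices; the length bound excludes
  walking back and forth along a single edge.
\<close>

definition is_cycle :: "'a wgraph \<Rightarrow> 'a list \<Rightarrow> bool" where
  "is_cycle G vs \<longleftrightarrow>
     3 \<le> length vs \<and> distinct vs \<and> set vs \<subseteq> verts G \<and>
     (\<forall>i<length vs. {vs ! i, vs ! (Suc i mod length vs)} \<in> edges G)"

definition weighted_forest :: "nat \<Rightarrow> nat wgraph \<Rightarrow> bool" where
  "weighted_forest n G \<longleftrightarrow> weighted_graph n G \<and> (\<nexists>vs. is_cycle G vs)"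

definition edge_boundary :: "'a wgraph \<Rightarrow> 'a set \<Rightarrow> 'a set set" where
  "edge_boundary G A = {{u, v} | u v. {u, v} \<in> edges G \<and> u \<in> A \<and> v \<notin> A}"

definition phi :: "'a wgraph \<Rightarrow> 'a set \<Rightarrow> real" where
  "phi G A = (\<Sum>e\<in>edge_boundary G A. eweight G e) / (\<Sum>v\<in>A. vweight G v)"

definition disjoint_tuples :: "nat \<Rightarrow> 'a set \<Rightarrow> 'a set list set" where
  "disjoint_tuples m V =
     {As. length As = m \<and> (\<forall>A\<in>set As. A \<noteq> {} \<and> A \<subseteq> V) \<and>
          disjoint_family_on (\<lambda>i. As ! i) {..<m}}"

definition tuple_unions :: "'a set list \<Rightarrow> 'a set set" where
  "tuple_unions As = {\<Union>i\<in>I. As ! i | I. I \<subseteq> {..<length As} \<and> I \<noteq> {}}"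

definition h :: "'a wgraph \<Rightarrow> 'a set \<Rightarrow> real" where
  "h G A = (MIN B\<in>{B. B \<noteq> {} \<and> B \<subseteq> A}. phi G B)"

definition h_const :: "nat \<Rightarrow> 'a wgraph \<Rightarrow> real" where
  "h_const k G = (MIN As\<in>disjoint_tuples k (verts G). MAX i\<in>{..<k}. phi G (As ! i))"

text \<open>The subtractions below are on \<^typ>\<open>nat\<close>, so they are only meaningful for \<open>k \<le> card (verts G)\<close>.\<close>

definition ell :: "nat \<Rightarrow> 'a wgraph \<Rightarrow> real" where
  "ell k G =
     (MAX As\<in>disjoint_tuples (card (verts G) - k + 1) (verts G).
        MIN B\<in>tuple_unions As. phi G B)"

definition ell_lower :: "nat \<Rightarrow> 'a wgraph \<Rightarrow> real" where
  "ell_lower k G = (MAX A\<in>{A. A \<subseteq> verts G \<and> card A = card (verts G) - k + 1}. h G A)"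

text \<open>
  \<^const>\<open>Min\<close> and \<^const>\<open>Max\<close> are unspecified on empty and on infinite sets; the following facts
  show that all the index sets above are finite and nonempty.
\<close>

lemma finite_disjoint_tuples:
  assumes "finite V"
  shows "finite (disjoint_tuples m V)"
proof (rule finite_subset)
  show "disjoint_tuples m V \<subseteq> {As. set As \<subseteq> Pow V \<and> length As = m}"
    by (auto simp: disjoint_tuples_def)
  show "finite {As. set As \<subseteq> Pow V \<and> length As = m}"
    using assms by (intro finite_lists_length_eq) simp
qed

lemma disjoint_tuples_nonempty:
  assumes "finite V" "m \<le> card V"
  shows "disjoint_tuples m V \<noteq> {}"
proof -
  obtain W where W: "W \<subseteq> V" "card W = m" "finite W"
    using obtain_subset_with_card_n[OF assms(2)] by metis
  obtain vs where vs: "set vs = W" "distinct vs"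
    using finite_distinct_list[OF W(3)] by blast
  have len: "length vs = m"
    using vs W(2) distinct_card by fastforce
  have "map (\<lambda>v. {v}) vs \<in> disjoint_tuples m V"
    using vs W(1) len
    by (auto simp: disjoint_tuples_def disjoint_family_on_def nth_eq_iff_index_eq)
  then show ?thesis by blast
qed

lemma finite_tuple_unions: "finite (tuple_unions As)"
proof -
  have "tuple_unions As \<subseteq> (\<lambda>I. \<Union>i\<in>I. As ! i) ` Pow {..<length As}"
    by (auto simp: tuple_unions_def)
  then show ?thesis by (rule finite_subset) simp
qed

lemma tuple_unions_nonempty: "As \<noteq> [] \<Longrightarrow> tuple_unions As \<noteq> {}"
  by (auto simp: tuple_unions_def)

lemma finite_card_subsets:
  "finite V \<Longrightarrow> finite {A. A \<subseteq> V \<and> card A = m}"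
  by simp

lemma card_subsets_nonempty:
  "m \<le> card V \<Longrightarrow> {A. A \<subseteq> V \<and> card A = m} \<noteq> {}"
  using obtain_subset_with_card_n[of m V] by blast

lemma finite_nonempty_subsets:
  "finite A \<Longrightarrow> finite {B. B \<noteq> {} \<and> B \<subseteq> A}"
  by simp

lemma nonempty_subsets_nonempty:
  "A \<noteq> {} \<Longrightarrow> {B. B \<noteq> {} \<and> B \<subseteq> A} \<noteq> {}"
  by blast

end

theory Submission
  imports Defs
begin

text \<open>
  The inequality between \<^const>\<open>h_const\<close> and \<^const>\<open>ell\<close> is a counting argument. Disjoint sets
  \<open>A\<^sub>1, \<dots>, A\<^sub>k\<close> and disjoint sets \<open>B\<^sub>1, \<dots>, B\<^sub>m\<close> with \<open>m = n - k + 1\<close> are \<open>n + 1\<close> sets on \<open>n\<close> points,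
  which forces some union of \<open>A\<^sub>i\<close>s to equal some union of \<open>B\<^sub>j\<close>s (lemma \<open>common_union\<close>). Merging
  disjoint sets can only lose boundary edges, so \<^const>\<open>phi\<close> of a union of \<open>A\<^sub>i\<close>s is at most
  the largest \<open>\<phi>(A\<^sub>i)\<close> (lemma \<open>phi_UN_le\<close>); this set is therefore a union of \<open>B\<^sub>j\<close>s with small \<^const>\<open>phi\<close>.
  For the inequality between \<^const>\<open>ell\<close> and \<^const>\<open>ell_lower\<close>, a set \<open>A\<close> is viewed as the tuple of
  its singletons.

  For forests, let \<open>\<lambda>\<close> be the value of \<^const>\<open>ell_lower\<close> and call \<open>B\<close> good if \<open>\<phi>(B) \<le> \<lambda>\<close>. By choice of
  \<open>\<lambda>\<close>, no set of fewer than \<open>k\<close> vertices meets all good sets, because its complement contains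
  \<open>n - k + 1\<close> vertices. A good set that splits into two parts without edges between them has a good
  part, since its \<^const>\<open>phi\<close> is a weighted mean of those of the parts; hence each good set contains a
  connected good set (lemma \<open>connected_subset_phi_le\<close>), and no set of fewer than \<open>k\<close> vertices meets
  all connected good sets. In a forest, connected sets have the same packing and covering numbers
  (lemma \<open>packing_covers\<close>), so there are \<open>k\<close> pairwise disjoint good sets, which bound
  \<^const>\<open>h_const\<close> by \<open>\<lambda>\<close>.
\<close>

section \<open>Common unions of two disjoint families\<close>

text \<open>
  A multigraph with \<open>|X|\<close> edges (the edge \<open>x\<close> joins \<open>r x\<close> and \<open>s x\<close>) and at least \<open>|X| + 2\<close> nodes is
  disconnected, so it has a union of components that avoids a given node \<open>z\<close>. The induction
  contracts one edge at a time.
\<close>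

lemma closed_set_avoiding_node:
  assumes "finite X" "finite N" "r ` X \<subseteq> N" "s ` X \<subseteq> N" "z \<in> N" "card X + 2 \<le> card N"
  shows "\<exists>S\<subseteq>N. S \<noteq> {} \<and> z \<notin> S \<and> (\<forall>x\<in>X. r x \<in> S \<longleftrightarrow> s x \<in> S)"
  using assms
proof (induction X arbitrary: N z r s rule: finite_induct)
  case empty
  have "\<not> N \<subseteq> {z}"
    using empty card_mono[of "{z}" N] by auto
  then obtain y where "y \<in> N" "y \<noteq> z" by auto
  then show ?case by (intro exI[of _ "{y}"]) auto
next
  case (insert x X)
  define q where "q = (\<lambda>v. if v = r x then s x else v)"
  have "N - {r x} \<subseteq> q ` N"
    by (auto simp: q_def image_iff)
  then have "card N - 1 \<le> card (q ` N)"
    using card_mono[of "q ` N" "N - {r x}"] \<open>finite N\<close> card_Diff_singleton_if[of N "r x"]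
    by (auto split: if_splits)
  then have "card X + 2 \<le> card (q ` N)"
    using insert.prems insert.hyps by simp
  moreover have "(q \<circ> r) ` X \<subseteq> q ` N" "(q \<circ> s) ` X \<subseteq> q ` N" "q z \<in> q ` N"
    using insert.prems by auto
  ultimately obtain S where S: "S \<subseteq> q ` N" "S \<noteq> {}" "q z \<notin> S"
      "\<forall>y\<in>X. (q \<circ> r) y \<in> S \<longleftrightarrow> (q \<circ> s) y \<in> S"
    using insert.IH[of "q ` N" "q \<circ> r" "q \<circ> s" "q z"] \<open>finite N\<close> by blast
  have "q (r x) = q (s x)" by (simp add: q_def)
  then have "\<forall>y\<in>insert x X. r y \<in> {v \<in> N. q v \<in> S} \<longleftrightarrow> s y \<in> {v \<in> N. q v \<in> S}"
    using S(4) insert.prems by auto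
  then show ?case
    using S(1-3) by (intro exI[of _ "{v \<in> N. q v \<in> S}"]) auto
qed

text \<open>
  The nodes are the members of both families and one further node \<open>z\<close>; a point \<open>x\<close> joins
  the set \<open>A i\<close> that contains it to the set \<open>B j\<close> that contains it, where \<open>z\<close> replaces a set that
  does not exist. A union of components avoiding \<open>z\<close> then selects \<open>A\<close>s and \<open>B\<close>s that cover the same
  points.
\<close>

lemma common_union:
  assumes V: "finite V" and pq: "p + q = card V + 1"
    and A: "\<And>i. i < p \<Longrightarrow> A i \<noteq> {} \<and> A i \<subseteq> V" "disjoint_family_on A {..<p}"
    and B: "\<And>j. j < q \<Longrightarrow> B j \<noteq> {} \<and> B j \<subseteq> V" "disjoint_family_on B {..<q}"
  shows "\<exists>I\<subseteq>{..<p}. \<exists>J\<subseteq>{..<q}. I \<noteq> {} \<and> J \<noteq> {} \<and> (\<Union>i\<in>I. A i) = (\<Union>j\<in>J. B j)"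
proof -
  define z :: "nat + nat" where "z = Inl p"
  define N :: "(nat + nat) set" where "N = insert z (Inl ` {..<p} \<union> Inr ` {..<q})"
  define r :: "'a \<Rightarrow> nat + nat"
    where "r x = (if \<exists>i<p. x \<in> A i then Inl (SOME i. i < p \<and> x \<in> A i) else z)" for x
  define s :: "'a \<Rightarrow> nat + nat"
    where "s x = (if \<exists>j<q. x \<in> B j then Inr (SOME j. j < q \<and> x \<in> B j) else z)" for x
  have r_in: "r x = Inl i" if "i < p" "x \<in> A i" for i x
  proof -
    have "(SOME i. i < p \<and> x \<in> A i) = i"
      using that A(2) by (intro some_equality) (auto simp: disjoint_family_on_def)
    then show ?thesis using that by (auto simp: r_def)
  qed
  have s_in: "s x = Inr j" if "j < q" "x \<in> B j" for j x
  proof -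
    have "(SOME j. j < q \<and> x \<in> B j) = j"
      using that B(2) by (intro some_equality) (auto simp: disjoint_family_on_def)
    then show ?thesis using that by (auto simp: s_def)
  qed
  have r_cases: "r x = z \<or> (\<exists>i<p. x \<in> A i \<and> r x = Inl i)" for x
    using r_in unfolding r_def by meson
  have s_cases: "s x = z \<or> (\<exists>j<q. x \<in> B j \<and> s x = Inr j)" for x
    using s_in unfolding s_def by meson
  have fin: "finite N" by (simp add: N_def)
  have zN: "z \<in> N" by (simp add: N_def)
  have "r x \<in> N" "s x \<in> N" for x
    using r_cases[of x] s_cases[of x] by (auto simp: N_def)
  then have rs: "r ` V \<subseteq> N" "s ` V \<subseteq> N" by auto
  have "card N = Suc (card (Inl ` {..<p} \<union> Inr ` {..<q} :: (nat + nat) set))"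
    unfolding N_def by (intro card_insert_disjoint) (auto simp: z_def)
  also have "card (Inl ` {..<p} \<union> Inr ` {..<q} :: (nat + nat) set) = p + q"
    by (subst card_Un_disjoint) (auto simp: card_image)
  finally have card: "card V + 2 \<le> card N" using pq by simp
  obtain S where S: "S \<subseteq> N" "S \<noteq> {}" "z \<notin> S" "\<forall>x\<in>V. r x \<in> S \<longleftrightarrow> s x \<in> S"
    using closed_set_avoiding_node[OF V fin rs zN card] by (elim exE conjE)
  define I where "I = {i. i < p \<and> Inl i \<in> S}"
  define J where "J = {j. j < q \<and> Inr j \<in> S}"
  have A_iff: "x \<in> (\<Union>i\<in>I. A i) \<longleftrightarrow> r x \<in> S" for x
  proof
    assume "x \<in> (\<Union>i\<in>I. A i)"
    then obtain i where "i \<in> I" "x \<in> A i" by blast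
    then show "r x \<in> S" using r_in[of i x] by (simp add: I_def)
  next
    assume x: "r x \<in> S"
    then have "r x \<noteq> z" using S(3) by metis
    then obtain i where "i < p" "x \<in> A i" "r x = Inl i"
      using r_cases[of x] by metis
    then show "x \<in> (\<Union>i\<in>I. A i)" using x by (auto simp: I_def)
  qed
  have B_iff: "x \<in> (\<Union>j\<in>J. B j) \<longleftrightarrow> s x \<in> S" for x
  proof
    assume "x \<in> (\<Union>j\<in>J. B j)"
    then obtain j where "j \<in> J" "x \<in> B j" by blast
    then show "s x \<in> S" using s_in[of j x] by (simp add: J_def)
  next
    assume x: "s x \<in> S"
    then have "s x \<noteq> z" using S(3) by metis
    then obtain j where "j < q" "x \<in> B j" "s x = Inr j"
      using s_cases[of x] by metis
    then show "x \<in> (\<Union>j\<in>J. B j)" using x by (auto simp: J_def)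
  qed
  have "(\<Union>i\<in>I. A i) \<subseteq> V" "(\<Union>j\<in>J. B j) \<subseteq> V"
    using A(1) B(1) by (auto simp: I_def J_def)
  then have eq: "(\<Union>i\<in>I. A i) = (\<Union>j\<in>J. B j)"
    using A_iff B_iff S(4) by (intro set_eqI) (metis subsetD)
  have "I \<noteq> {} \<or> J \<noteq> {}"
    using S(1-3) by (auto simp: I_def J_def N_def)
  moreover have "(\<Union>i\<in>I. A i) \<noteq> {}" if "I \<noteq> {}"
    using that A(1) by (auto simp: I_def)
  moreover have "(\<Union>j\<in>J. B j) \<noteq> {}" if "J \<noteq> {}"
    using that B(1) by (auto simp: J_def)
  ultimately have "I \<noteq> {}" "J \<noteq> {}"
    using eq by (metis UN_empty)+
  moreover have "I \<subseteq> {..<p}" "J \<subseteq> {..<q}" by (auto simp: I_def J_def)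
  ultimately show ?thesis using eq by (intro exI[of _ I] exI[of _ J] conjI)
qed

section \<open>The ratio of a union\<close>

lemma finite_edges:
  assumes "weighted_graph n G"
  shows "finite (edges G)"
proof (rule finite_subset)
  show "edges G \<subseteq> Pow {1..n}" using assms by (auto simp: weighted_graph_def)
qed simp

lemma edge_boundary_subset: "edge_boundary G A \<subseteq> edges G"
  by (auto simp: edge_boundary_def)

lemma finite_edge_boundary:
  "weighted_graph n G \<Longrightarrow> finite (edge_boundary G A)"
  using finite_edges edge_boundary_subset finite_subset by metis

lemma finite_vertex_set:
  "weighted_graph n G \<Longrightarrow> A \<subseteq> verts G \<Longrightarrow> finite A"
  using finite_subset by (fastforce simp: weighted_graph_def)

lemma sum_vweight_pos:
  assumes "weighted_graph n G" "A \<subseteq> verts G" "A \<noteq> {}"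
  shows "(\<Sum>v\<in>A. vweight G v) > 0"
  using assms finite_vertex_set[OF assms(1,2)]
  by (intro sum_pos) (auto simp: weighted_graph_def)

lemma phi_le_iff:
  assumes "weighted_graph n G" "A \<subseteq> verts G" "A \<noteq> {}"
  shows "phi G A \<le> c \<longleftrightarrow> (\<Sum>e\<in>edge_boundary G A. eweight G e) \<le> c * (\<Sum>v\<in>A. vweight G v)"
  using sum_vweight_pos[OF assms] by (simp add: phi_def pos_divide_le_eq)

lemma phi_Un_le:
  assumes G: "weighted_graph n G"
    and A: "A \<subseteq> verts G" "A \<noteq> {}" "phi G A \<le> c"
    and B: "B \<subseteq> verts G" "B \<noteq> {}" "phi G B \<le> c"
    and disj: "A \<inter> B = {}"
  shows "phi G (A \<union> B) \<le> c"
proof -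
  let ?w = "\<lambda>A. \<Sum>e\<in>edge_boundary G A. eweight G e"
  let ?m = "\<lambda>A. \<Sum>v\<in>A. vweight G v"
  have "edge_boundary G (A \<union> B) \<subseteq> edge_boundary G A \<union> edge_boundary G B"
    by (auto simp: edge_boundary_def)
  moreover have pos: "\<forall>e\<in>edge_boundary G A \<union> edge_boundary G B. 0 \<le> eweight G e"
    using G edge_boundary_subset by (fastforce simp: weighted_graph_def)
  ultimately have "?w (A \<union> B) \<le> (\<Sum>e\<in>edge_boundary G A \<union> edge_boundary G B. eweight G e)"
    by (intro sum_mono2) (auto simp: finite_edge_boundary[OF G])
  also have "\<dots> \<le> ?w A + ?w B"
    using pos by (subst sum_Un) (auto simp: finite_edge_boundary[OF G] intro!: sum_nonneg)
  also have "\<dots> \<le> c * ?m A + c * ?m B"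
    using A B by (intro add_mono) (auto simp: phi_le_iff[OF G])
  also have "\<dots> = c * ?m (A \<union> B)"
    using A B disj by (simp add: sum.union_disjoint finite_vertex_set[OF G] distrib_left)
  finally show ?thesis
    using A B by (simp add: phi_le_iff[OF G])
qed

lemma phi_UN_le:
  assumes G: "weighted_graph n G" and "finite I" "I \<noteq> {}"
    and "\<And>i. i \<in> I \<Longrightarrow> A i \<subseteq> verts G \<and> A i \<noteq> {} \<and> phi G (A i) \<le> c"
    and "disjoint_family_on A I"
  shows "phi G (\<Union>i\<in>I. A i) \<le> c"
  using assms(2-)
proof (induction I rule: finite_ne_induct)
  case (singleton x)
  then show ?case by simp
next
  case (insert x I)
  have "disjoint_family_on A I"
    using insert.prems(2) by (auto simp: disjoint_family_on_def)
  moreover have "A x \<inter> (\<Union>i\<in>I. A i) = {}"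
    using insert.prems(2) insert.hyps by (auto simp: disjoint_family_on_def)
  moreover have "(\<Union>i\<in>I. A i) \<subseteq> verts G" "(\<Union>i\<in>I. A i) \<noteq> {}"
    using insert.prems(1) insert.hyps by auto
  ultimately have "phi G (A x \<union> (\<Union>i\<in>I. A i)) \<le> c"
    using insert.prems(1) insert.IH by (intro phi_Un_le[OF G]) auto
  then show ?case by simp
qed

section \<open>Connected vertex sets\<close>

text \<open>
  Connectivity is expressed by cuts instead of walks, since cuts are what the mean argument below
  produces.
\<close>

definition connected_in :: "'a set set \<Rightarrow> 'a set \<Rightarrow> bool" where
  "connected_in E B \<longleftrightarrow> (\<forall>C. C \<subset> B \<longrightarrow> C \<noteq> {} \<longrightarrow> (\<exists>x\<in>C. \<exists>y\<in>B - C. {x, y} \<in> E))"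

text \<open>
  Without edges between \<open>C\<close> and \<open>D\<close>, the boundary of the union is the disjoint union of the
  boundaries, so the ratio of the union is a weighted mean of the two ratios.
\<close>

lemma phi_le_part:
  assumes G: "weighted_graph n G"
    and C: "C \<subseteq> verts G" "C \<noteq> {}" and D: "D \<subseteq> verts G" "D \<noteq> {}"
    and disj: "C \<inter> D = {}" and no_edge: "\<And>x y. x \<in> C \<Longrightarrow> y \<in> D \<Longrightarrow> {x, y} \<notin> edges G"
    and le: "phi G (C \<union> D) \<le> c"
  shows "phi G C \<le> c \<or> phi G D \<le> c"
proof (rule ccontr)
  let ?w = "\<lambda>A. \<Sum>e\<in>edge_boundary G A. eweight G e"
  let ?m = "\<lambda>A. \<Sum>v\<in>A. vweight G v"
  assume "\<not> ?thesis"
  then have gt: "c * ?m C < ?w C" "c * ?m D < ?w D"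
    using C D by (auto simp: phi_le_iff[OF G])
  have no_edge': "{y, x} \<notin> edges G" if "x \<in> C" "y \<in> D" for x y
    using no_edge[OF that] by (simp add: insert_commute)
  have sub: "edge_boundary G C \<union> edge_boundary G D \<subseteq> edge_boundary G (C \<union> D)"
    using no_edge no_edge' unfolding edge_boundary_def by blast
  have dis: "edge_boundary G C \<inter> edge_boundary G D = {}"
    using no_edge no_edge' disj unfolding edge_boundary_def by (auto simp: doubleton_eq_iff)
  have "?w C + ?w D = (\<Sum>e\<in>edge_boundary G C \<union> edge_boundary G D. eweight G e)"
    using dis by (simp add: sum.union_disjoint finite_edge_boundary[OF G])
  also have "\<dots> \<le> ?w (C \<union> D)"
    using sub G edge_boundary_subset[of G]
    by (intro sum_mono2) (fastforce simp: finite_edge_boundary[OF G] weighted_graph_def)+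
  also have "\<dots> \<le> c * ?m (C \<union> D)"
    using le C D by (simp add: phi_le_iff[OF G])
  also have "\<dots> = c * ?m C + c * ?m D"
    using C D disj by (simp add: sum.union_disjoint finite_vertex_set[OF G] distrib_left)
  finally show False using gt by linarith
qed

text \<open>A smallest nonempty subset of ratio at most \<open>c\<close> cannot be split, by the previous lemma.\<close>

lemma connected_subset_phi_le:
  assumes G: "weighted_graph n G" and B: "B \<subseteq> verts G" "B \<noteq> {}" "phi G B \<le> c"
  shows "\<exists>C\<subseteq>B. C \<noteq> {} \<and> connected_in (edges G) C \<and> phi G C \<le> c"
  using B
proof (induction "card B" arbitrary: B rule: less_induct)
  case less
  show ?case
  proof (cases "connected_in (edges G) B")
    case True
    then show ?thesis using less.prems by blast
  next
    case False
    then obtain C where C: "C \<subset> B" "C \<noteq> {}" "\<And>x y. x \<in> C \<Longrightarrow> y \<in> B - C \<Longrightarrow> {x, y} \<notin> edges G"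
      unfolding connected_in_def by blast
    have "C \<union> (B - C) = B" using C(1) by blast
    then have "phi G C \<le> c \<or> phi G (B - C) \<le> c"
      using C less.prems by (intro phi_le_part[OF G]) auto
    moreover have "card C < card B" "card (B - C) < card B"
      using C(1,2) finite_vertex_set[OF G less.prems(1)]
      by (auto intro!: psubset_card_mono)
    moreover have "C \<subseteq> B" "B - C \<subseteq> B" "B - C \<noteq> {}" using C(1) by auto
    ultimately obtain D where D: "D \<subseteq> B" "D \<noteq> {}" "phi G D \<le> c" "card D < card B"
      using C(2) by blast
    then show ?thesis using less.hyps[of D] less.prems(1) by (meson subset_trans)
  qed
qed

section \<open>Packing and covering connected sets in a forest\<close>

text \<open>
  If every vertex of \<open>W\<close> had two neighbours in \<open>W\<close>, the first vertex of a longest path would have a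
  neighbour on the path beyond its second vertex, which closes a cycle.
\<close>

lemma forest_has_leaf:
  assumes G: "weighted_forest n G" and W: "W \<subseteq> verts G" "W \<noteq> {}"
  shows "\<exists>v\<in>W. \<forall>x\<in>W. \<forall>y\<in>W. {v, x} \<in> edges G \<longrightarrow> {v, y} \<in> edges G \<longrightarrow> x = y"
proof (rule ccontr)
  assume neg: "\<not> ?thesis"
  define path where "path vs \<longleftrightarrow> vs \<noteq> [] \<and> distinct vs \<and> set vs \<subseteq> W \<and>
    (\<forall>i. Suc i < length vs \<longrightarrow> {vs ! i, vs ! Suc i} \<in> edges G)" for vs
  have wg: "weighted_graph n G" using G by (simp add: weighted_forest_def)
  have finW: "finite W" using finite_vertex_set[OF wg W(1)] .
  obtain w where "w \<in> W" using W(2) by blast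
  then have "path [w]" by (simp add: path_def)
  moreover have "\<forall>vs. path vs \<longrightarrow> length vs \<le> card W"
    using finW by (auto simp: path_def distinct_card[symmetric] intro!: card_mono)
  ultimately obtain vs where vs: "path vs" "\<And>us. path us \<Longrightarrow> length us \<le> length vs"
    using ex_has_greatest_nat[of path "[w]" length "Suc (card W)"] by (auto simp: less_Suc_eq_le)
  have on_path: "x \<in> set vs" if "x \<in> W" "{vs ! 0, x} \<in> edges G" for x
  proof (rule ccontr)
    assume "x \<notin> set vs"
    then have "path (x # vs)"
      using vs(1) that by (auto simp: path_def nth_Cons insert_commute split: nat.split)
    then show False using vs(2)[of "x # vs"] by simp
  qed
  have "vs ! 0 \<in> W" using vs(1) by (auto simp: path_def)
  then obtain x y where xy: "x \<in> W" "y \<in> W" "x \<noteq> y" "{vs ! 0, x} \<in> edges G" "{vs ! 0, y} \<in> edges G"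
    using neg by blast
  obtain i j where ij: "i < length vs" "vs ! i = x" "j < length vs" "vs ! j = y"
    using on_path xy by (metis in_set_conv_nth)
  have no_loop: "{v} \<notin> edges G" for v
    using wg by (auto simp: weighted_graph_def)
  have "i \<noteq> 0" "j \<noteq> 0" "i \<noteq> j" using ij xy no_loop by (auto intro!: gr0I)
  then have "2 \<le> i \<or> 2 \<le> j" by linarith
  then obtain m where m: "2 \<le> m" "m < length vs" "{vs ! 0, vs ! m} \<in> edges G"
    using ij xy by blast
  have len: "length (take (Suc m) vs) = Suc m" using m by simp
  have "is_cycle G (take (Suc m) vs)"
    unfolding is_cycle_def
  proof (intro conjI allI impI)
    show "3 \<le> length (take (Suc m) vs)" using m by simp
    show "distinct (take (Suc m) vs)" using vs(1) by (simp add: path_def)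
    show "set (take (Suc m) vs) \<subseteq> verts G"
      using vs(1) W(1) set_take_subset[of "Suc m" vs] by (auto simp: path_def)
    fix l assume "l < length (take (Suc m) vs)"
    then consider "l < m" | "l = m" by fastforce
    then show "{take (Suc m) vs ! l, take (Suc m) vs ! (Suc l mod length (take (Suc m) vs))} \<in> edges G"
      unfolding len using m vs(1) by cases (auto simp: path_def insert_commute)
  qed
  then show False using G by (auto simp: weighted_forest_def)
qed

text \<open>
  The induction removes a vertex \<open>v\<close> with at most one neighbour \<open>u\<close>. If \<open>{v}\<close> is in the family, it can
  be packed, and \<open>v\<close> covers the members that intersect it. Otherwise each member containing \<open>v\<close>
  also contains \<open>u\<close>; so deleting \<open>v\<close> from all members keeps them connected, and it does not make two
  intersecting members disjoint.
\<close>

lemma packing_covers: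
  assumes "finite V"
    and "\<And>W. W \<subseteq> V \<Longrightarrow> W \<noteq> {} \<Longrightarrow>
           \<exists>v\<in>W. \<forall>x\<in>W. \<forall>y\<in>W. {v, x} \<in> E \<longrightarrow> {v, y} \<in> E \<longrightarrow> x = y"
    and "\<And>B. B \<in> F \<Longrightarrow> B \<noteq> {} \<and> B \<subseteq> V \<and> connected_in E B"
  shows "\<exists>M\<subseteq>F. \<exists>T\<subseteq>V. finite M \<and> disjoint M \<and> card T \<le> card M \<and> (\<forall>B\<in>F. B \<inter> T \<noteq> {})"
  using assms
proof (induction "card V" arbitrary: V F)
  case 0
  then have "F = {}" by auto
  then show ?case by (intro exI[of _ "{}"]) auto
next
  case (Suc k)
  have "V \<noteq> {}" using Suc.hyps(2) by auto
  then obtain v where v: "v \<in> V"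
      "\<And>x y. x \<in> V \<Longrightarrow> y \<in> V \<Longrightarrow> {v, x} \<in> E \<Longrightarrow> {v, y} \<in> E \<Longrightarrow> x = y"
    using Suc.prems(2)[of V] by blast
  define V' where "V' = V - {v}"
  have V': "k = card V'" "finite V'"
    using Suc.hyps(2) Suc.prems(1) v(1) by (auto simp: V'_def)
  have leaf': "\<exists>v\<in>W. \<forall>x\<in>W. \<forall>y\<in>W. {v, x} \<in> E \<longrightarrow> {v, y} \<in> E \<longrightarrow> x = y"
    if "W \<subseteq> V'" "W \<noteq> {}" for W
    using that Suc.prems(2)[of W] by (auto simp: V'_def)
  show ?case
  proof (cases "{v} \<in> F")
    case True
    have "B \<noteq> {} \<and> B \<subseteq> V' \<and> connected_in E B" if "B \<in> {B \<in> F. v \<notin> B}" for B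
      using that Suc.prems(3) by (auto simp: V'_def)
    then obtain M T where M: "M \<subseteq> {B \<in> F. v \<notin> B}" "finite M" "disjoint M"
      and T: "T \<subseteq> V'" "card T \<le> card M" "\<forall>B\<in>{B \<in> F. v \<notin> B}. B \<inter> T \<noteq> {}"
      using Suc.hyps(1)[OF V' leaf', of "{B \<in> F. v \<notin> B}"] by blast
    have "{v} \<notin> M" using M(1) by auto
    then have "card (insert v T) \<le> card (insert {v} M)"
      using M(2) T(2) card_insert_le_m1[of "Suc (card T)" T v] by (simp add: card_insert_if)
    moreover have "disjoint (insert {v} M)"
      using M by (auto simp: pairwise_insert disjnt_def)
    ultimately show ?thesis
      using M T True v(1)
      by (intro exI[of _ "insert {v} M"] exI[of _ "insert v T"] conjI) (auto simp: V'_def)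
  next
    case False
    have nbr: "\<exists>u\<in>B. u \<noteq> v \<and> {v, u} \<in> E" if B: "B \<in> F" "v \<in> B" for B
    proof -
      have "{v} \<subset> B" using B False by blast
      then show ?thesis
        using Suc.prems(3)[OF B(1)] unfolding connected_in_def by blast
    qed
    define F' where "F' = (\<lambda>B. B - {v}) ` F"
    have "B' \<noteq> {} \<and> B' \<subseteq> V' \<and> connected_in E B'" if B'F: "B' \<in> F'" for B'
    proof -
      obtain B where B: "B \<in> F" "B' = B - {v}" using B'F by (auto simp: F'_def)
      note props = Suc.prems(3)[OF B(1)]
      have "B' \<noteq> {}"
        using nbr[OF B(1)] props B(2) by (cases "v \<in> B") auto
      moreover have "connected_in E B'"
        unfolding connected_in_def
      proof (intro allI impI)
        fix C assume C: "C \<subset> B'" "C \<noteq> {}"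
        show "\<exists>x\<in>C. \<exists>y\<in>B' - C. {x, y} \<in> E"
        proof (cases "v \<in> B")
          case False
          then have "B' = B" using B(2) by auto
          then show ?thesis using C props by (auto simp: connected_in_def)
        next
          case True
          obtain u where u: "u \<in> B" "u \<noteq> v" "{v, u} \<in> E"
            using nbr[OF B(1) True] by blast
          have uniq: "y = u" if "y \<in> B" "{v, y} \<in> E \<or> {y, v} \<in> E" for y
            using v(2)[of y u] that u props by (auto simp: insert_commute)
          \<comment> \<open>The leaf \<open>v\<close> is put on the side of its neighbour, so that no edge at \<open>v\<close> crosses.\<close>
          define C' where "C' = (if u \<in> C then insert v C else C)"
          have "C' \<subset> B" "C' \<noteq> {}" using C B(2) True by (auto simp: C'_def)
          then obtain x y where xy: "x \<in> C'" "y \<in> B - C'" "{x, y} \<in> E"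
            using props unfolding connected_in_def by blast
          have "x \<noteq> v" "y \<noteq> v"
            using xy uniq[of x] uniq[of y] C B(2) u by (auto simp: C'_def split: if_splits)
          then show ?thesis
            using xy B(2) C by (auto simp: C'_def split: if_splits)
        qed
      qed
      ultimately show ?thesis using props B(2) by (auto simp: V'_def)
    qed
    then obtain M T where M: "M \<subseteq> F'" "finite M" "disjoint M"
      and T: "T \<subseteq> V'" "card T \<le> card M" "\<forall>B\<in>F'. B \<inter> T \<noteq> {}"
      using Suc.hyps(1)[OF V' leaf', of F'] by blast
    have "\<forall>B'\<in>M. \<exists>B\<in>F. B' = B - {v}" using M(1) by (auto simp: F'_def)
    then obtain g where g: "\<And>B'. B' \<in> M \<Longrightarrow> g B' \<in> F \<and> B' = g B' - {v}" by metis
    have "inj_on g M" using g by (metis inj_onI)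
    then have "card T \<le> card (g ` M)" using T(2) by (simp add: card_image)
    moreover have "disjoint (g ` M)"
    proof (intro disjointI)
      fix P Q assume "P \<in> g ` M" "Q \<in> g ` M" "P \<noteq> Q"
      then obtain P' Q' where PQ: "P' \<in> M" "Q' \<in> M" "P' \<noteq> Q'" "P = g P'" "Q = g Q'" by blast
      have "P' \<inter> Q' = {}" using M(3) PQ by (auto simp: disjoint_def)
      then have sub: "P \<inter> Q \<subseteq> {v}" using g PQ by blast
      have "v \<notin> P \<or> v \<notin> Q"
      proof (rule ccontr)
        assume neg: "\<not> ?thesis"
        have F: "P \<in> F" "Q \<in> F" using g PQ by auto
        obtain a b where "a \<in> P" "a \<noteq> v" "{v, a} \<in> E" "b \<in> Q" "{v, b} \<in> E"
          using nbr F neg by meson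
        moreover from this have "a = b"
          using v(2)[of a b] Suc.prems(3) F by blast
        ultimately show False using sub by blast
      qed
      then show "P \<inter> Q = {}" using sub by blast
    qed
    moreover have "\<forall>B\<in>F. B \<inter> T \<noteq> {}" using T(3) by (fastforce simp: F'_def)
    ultimately show ?thesis
      using M(2) T(1) g by (intro exI[of _ "g ` M"] exI[of _ T] conjI) (auto simp: V'_def)
  qed
qed

section \<open>Comparison of the three constants\<close>

lemma h_const_le:
  assumes G: "weighted_graph n G" and k: "1 \<le> k"
    and As: "As \<in> disjoint_tuples k (verts G)" "\<And>i. i < k \<Longrightarrow> phi G (As ! i) \<le> c"
  shows "h_const k G \<le> c"
proof -
  have "finite (disjoint_tuples k (verts G))"
    using finite_disjoint_tuples finite_vertex_set[OF G] by blast
  then have "h_const k G \<le> (MAX i\<in>{..<k}. phi G (As ! i))"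
    unfolding h_const_def using As(1) by (intro Min_le) auto
  also have "\<dots> \<le> c"
    using As(2) k by (intro Max.boundedI) (auto simp: lessThan_empty_iff)
  finally show ?thesis .
qed

lemma ell_le_h_const:
  assumes G: "weighted_graph n G" and k: "k \<in> {1..n}"
  shows "ell k G \<le> h_const k G"
proof -
  have V: "finite (verts G)" "card (verts G) = n" using G by (auto simp: weighted_graph_def)
  define m where "m = n - k + 1"
  have m: "1 \<le> m" "m \<le> n" "k + m = card (verts G) + 1" using k V by (auto simp: m_def)
  have key: "(MIN B\<in>tuple_unions Bs. phi G B) \<le> (MAX i\<in>{..<k}. phi G (As ! i))"
    if As: "As \<in> disjoint_tuples k (verts G)" and Bs: "Bs \<in> disjoint_tuples m (verts G)" for As Bs
  proof -
    have A: "As ! i \<noteq> {} \<and> As ! i \<subseteq> verts G" if "i < k" for i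
      using As that by (auto simp: disjoint_tuples_def)
    have B: "Bs ! j \<noteq> {} \<and> Bs ! j \<subseteq> verts G" if "j < m" for j
      using Bs that by (auto simp: disjoint_tuples_def)
    have lenB: "length Bs = m" using Bs by (auto simp: disjoint_tuples_def)
    have "disjoint_family_on (\<lambda>i. As ! i) {..<k}" "disjoint_family_on (\<lambda>j. Bs ! j) {..<m}"
      using As Bs by (auto simp: disjoint_tuples_def)
    note disj = this
    have "\<exists>I\<subseteq>{..<k}. \<exists>J\<subseteq>{..<m}. I \<noteq> {} \<and> J \<noteq> {} \<and>
        (\<Union>i\<in>I. As ! i) = (\<Union>j\<in>J. Bs ! j)"
      by (rule common_union[OF V(1) m(3)]) (fact A B disj)+
    then obtain I J where IJ: "I \<subseteq> {..<k}" "J \<subseteq> {..<m}" "I \<noteq> {}" "J \<noteq> {}"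
        "(\<Union>i\<in>I. As ! i) = (\<Union>j\<in>J. Bs ! j)"
      by (elim exE conjE)
    have "(\<Union>j\<in>J. Bs ! j) \<in> tuple_unions Bs"
      using IJ(2,4) lenB by (auto simp: tuple_unions_def)
    then have "(MIN B\<in>tuple_unions Bs. phi G B) \<le> phi G (\<Union>i\<in>I. As ! i)"
      unfolding IJ(5) by (intro Min_le) (auto simp: finite_tuple_unions)
    also have "\<dots> \<le> (MAX i\<in>{..<k}. phi G (As ! i))"
    proof (rule phi_UN_le[OF G _ IJ(3)])
      show "finite I" using IJ(1) finite_subset by blast
      show "disjoint_family_on (\<lambda>i. As ! i) I"
        using disj(1) IJ(1) by (auto simp: disjoint_family_on_def)
    qed (use A IJ(1) in \<open>auto intro!: Max_ge\<close>)
    finally show ?thesis .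
  qed
  have ne: "disjoint_tuples k (verts G) \<noteq> {}" "disjoint_tuples m (verts G) \<noteq> {}"
    using k m(2) V(2) by (simp_all add: disjoint_tuples_nonempty[OF V(1)])
  show ?thesis
    unfolding ell_def h_const_def V(2) m_def[symmetric]
    using ne key finite_disjoint_tuples[OF V(1)]
    by (intro Max.boundedI Min.boundedI) auto
qed

lemma ell_lower_le_ell:
  assumes G: "weighted_graph n G" and k: "k \<in> {1..n}"
  shows "ell_lower k G \<le> ell k G"
proof -
  have V: "finite (verts G)" "card (verts G) = n" using G by (auto simp: weighted_graph_def)
  define m where "m = n - k + 1"
  have m: "1 \<le> m" "m \<le> n" using k by (auto simp: m_def)
  have "h G A \<le> ell k G" if A: "A \<subseteq> verts G" "card A = m" for A
  proof -
    have finA: "finite A" using A V finite_subset by blast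
    obtain vs where vs: "set vs = A" "distinct vs" using finite_distinct_list[OF finA] by blast
    have len: "length vs = m" using vs A(2) distinct_card by fastforce
    define As where "As = map (\<lambda>v. {v}) vs"
    have As: "As \<in> disjoint_tuples m (verts G)"
      using vs A len by (auto simp: As_def disjoint_tuples_def disjoint_family_on_def nth_eq_iff_index_eq)
    have sub: "tuple_unions As \<subseteq> {B. B \<noteq> {} \<and> B \<subseteq> A}"
    proof
      fix B assume "B \<in> tuple_unions As"
      then obtain I where I: "I \<subseteq> {..<m}" "I \<noteq> {}" "B = (\<Union>i\<in>I. As ! i)"
        using len by (auto simp: tuple_unions_def As_def)
      have "As ! i = {vs ! i}" if "i \<in> I" for i
        using that I(1) len by (auto simp: As_def)
      then have "B = (\<lambda>i. vs ! i) ` I" using I(3) by auto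
      then show "B \<in> {B. B \<noteq> {} \<and> B \<subseteq> A}" using I vs len by auto
    qed
    have "As \<noteq> []" using len m by (auto simp: As_def)
    then have "h G A \<le> (MIN B\<in>tuple_unions As. phi G B)"
      unfolding h_def using sub finA tuple_unions_nonempty
      by (intro Min_antimono) auto
    also have "\<dots> \<le> ell k G"
      unfolding ell_def V(2) m_def[symmetric]
      using As finite_disjoint_tuples[OF V(1)] by (intro Max_ge) auto
    finally show ?thesis .
  qed
  then show ?thesis
    unfolding ell_lower_def V(2) m_def[symmetric]
    using finite_card_subsets[OF V(1)] card_subsets_nonempty[of m "verts G"] m V(2)
    by (intro Max.boundedI) auto
qed

lemma h_const_le_ell_lower:
  assumes F: "weighted_forest n G" and k: "k \<in> {1..n}"
  shows "h_const k G \<le> ell_lower k G"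
proof -
  have G: "weighted_graph n G" using F by (simp add: weighted_forest_def)
  have V: "finite (verts G)" "card (verts G) = n" using G by (auto simp: weighted_graph_def)
  define c where "c = ell_lower k G"
  define good where
    "good = {B. B \<noteq> {} \<and> B \<subseteq> verts G \<and> connected_in (edges G) B \<and> phi G B \<le> c}"
  have "\<exists>M\<subseteq>good. \<exists>T\<subseteq>verts G. finite M \<and> disjoint M \<and> card T \<le> card M \<and>
      (\<forall>B\<in>good. B \<inter> T \<noteq> {})"
  proof (rule packing_covers[OF V(1)])
    show "\<exists>v\<in>W. \<forall>x\<in>W. \<forall>y\<in>W. {v, x} \<in> edges G \<longrightarrow> {v, y} \<in> edges G \<longrightarrow> x = y"
      if "W \<subseteq> verts G" "W \<noteq> {}" for W
      by (rule forest_has_leaf[OF F that])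
  qed (simp add: good_def)
  then obtain M T where M: "M \<subseteq> good" "finite M" "disjoint M"
    and T: "T \<subseteq> verts G" "card T \<le> card M" "\<forall>B\<in>good. B \<inter> T \<noteq> {}"
    by (elim exE conjE)
  have "k \<le> card T"
  proof (rule ccontr)
    assume "\<not> k \<le> card T"
    then have "n - k + 1 \<le> card (verts G - T)"
      using k T(1) V by (subst card_Diff_subset) (auto intro: finite_subset)
    then obtain A where A: "A \<subseteq> verts G - T" "card A = n - k + 1"
      using obtain_subset_with_card_n by metis
    have finA: "finite A" "A \<noteq> {}"
      using A(2) card_gt_0_iff[of A] by auto
    have "h G A \<le> c"
      unfolding c_def ell_lower_def V(2)
      using A finite_card_subsets[OF V(1)] by (intro Max_ge) auto
    then obtain B where B: "B \<noteq> {}" "B \<subseteq> A" "phi G B \<le> c"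
      unfolding h_def using finA by (subst (asm) Min_le_iff) auto
    have BV: "B \<subseteq> verts G" using A(1) B(2) by blast
    obtain C where C: "C \<subseteq> B" "C \<noteq> {}" "connected_in (edges G) C" "phi G C \<le> c"
      using connected_subset_phi_le[OF G BV B(1,3)] by (elim exE conjE)
    then have "C \<in> good" using BV by (simp add: good_def)
    then have "C \<inter> T \<noteq> {}" using T(3) by blast
    then show False using C(1) A(1) B(2) by blast
  qed
  then obtain M' where M': "M' \<subseteq> M" "card M' = k"
    using T(2) obtain_subset_with_card_n[of k M] by (metis le_trans)
  then obtain As where As: "set As = M'" "distinct As"
    using finite_distinct_list M(2) finite_subset by metis
  have len: "length As = k" using As M'(2) distinct_card by fastforce
  have "disjoint_family_on (\<lambda>i. As ! i) {..<k}"
    unfolding disjoint_family_on_def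
  proof (intro ballI impI)
    fix i j assume ij: "i \<in> {..<k}" "j \<in> {..<k}" "i \<noteq> j"
    then have "As ! i \<noteq> As ! j" "As ! i \<in> M" "As ! j \<in> M"
      using As M'(1) len by (auto simp: nth_eq_iff_index_eq)
    then show "As ! i \<inter> As ! j = {}" using M(3) by (auto simp: disjoint_def)
  qed
  then have "As \<in> disjoint_tuples k (verts G)"
    using As M'(1) M(1) len by (auto simp: disjoint_tuples_def good_def)
  moreover have "phi G (As ! i) \<le> c" if "i < k" for i
  proof -
    have "As ! i \<in> good" using that As M'(1) M(1) len nth_mem by blast
    then show ?thesis by (simp add: good_def)
  qed
  ultimately show ?thesis
    using h_const_le[OF G] k by (auto simp: c_def)
qed

theorem theorem3:
  shows "(\<forall>(n::nat) (G::nat wgraph). weighted_graph n G \<longrightarrow>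
            (\<forall>k\<in>{1..n}. h_const k G \<ge> ell k G \<and> ell k G \<ge> ell_lower k G)) \<and>
         (\<forall>(n::nat) (G::nat wgraph). weighted_forest n G \<longrightarrow>
            (\<forall>k\<in>{1..n}. h_const k G = ell k G \<and> ell k G = ell_lower k G))"
proof (intro conjI allI impI ballI)
  fix n k and G :: "nat wgraph"
  assume "weighted_graph n G" "k \<in> {1..n}"
  then show "ell k G \<le> h_const k G" "ell_lower k G \<le> ell k G"
    by (rule ell_le_h_const, rule ell_lower_le_ell)
next
  fix n k and G :: "nat wgraph"
  assume F: "weighted_forest n G" and k: "k \<in> {1..n}"
  then have G: "weighted_graph n G" by (simp add: weighted_forest_def)
  note chain = h_const_le_ell_lower[OF F k] ell_lower_le_ell[OF G k] ell_le_h_const[OF G k]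
  show "h_const k G = ell k G" "ell k G = ell_lower k G"
    using chain by auto
qed

end
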